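(* Let $G$ be a graph with $n$ vertices and $m$ edges, let $\sqrt{q_1},\dots,\sqrt{q_n}$ be the singular values of its incidence matrix $I(G)$, and let $I_I^1(G)$, $I_\alpha^2(G)$, $I_\alpha^3(G)$ be the generalized graph entropies formed from $\sqrt{q_1},\dots,\sqrt{q_n}$. Then for $\alpha\neq1$: (i) $I_I^1(G)=1-\frac{2m}{IE^2(G)}$; (ii) $I_\alpha^2(G)=\frac{1}{1-\alpha}\log\frac{M_\alpha^*}{IE^\alpha(G)}$; (iii) $I_\alpha^3(G)=\frac{1}{2^{1-\alpha}-1}\left(\frac{M_\alpha^*}{IE^\alpha(G)}-1\right)$, where $IE(G)$ is the incidence energy of $G$, $IE^\alpha(G)=(IE(G))^\alpha$, and $M_\alpha^*=\sum_{i=1}^n(\sqrt{q_i})^\alpha$.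
   Context: The graph $G$ has vertices $v_1,\dots,v_n$ and edges $e_1,\dots,e_m$. The incidence matrix $I(G)$ is the $n\times m$ matrix with $(i,j)$-entry $1$ if $v_i$ is incident with $e_j$ and $0$ otherwise. Let $Q(G)=D(G)+A(G)=I(G)I(G)^T$, where $D(G)$ is the diagonal matrix of vertex degrees and $A(G)$ the adjacency matrix, and let $q_1,\dots,q_n$ be the eigenvalues of $Q(G)$. The singular values of $I(G)$ are taken to be the $n$ numbers $\sqrt{q_1},\dots,\sqrt{q_n}$. The incidence energy is $IE(G)=\sum_{i=1}^n\sqrt{q_i}$. For numbers $\mu_1,\dots,\mu_n$ (listed with multiplicity), put $p_i=|\mu_i|/\sum_{j=1}^n|\mu_j|$. The generalized graph entropies formed from $\mu_1,\dots,\mu_n$ are $I^1=\sum_{i=1}^n p_i(1-p_i)$, $\quad I^2_\alpha=\frac{1}{1-\alpha}\log\left(\sum_{i=1}^n p_i^\alpha\right)$, $\quad I^3_\alpha=\frac{\sum_{i=1}^n p_i^\alpha-1}{2^{1-\alpha}-1}$ for $\alpha\ne1$, where $\log$ is the logarithm to a fixed base. The subscript on $I^1$ names the matrix used. *)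

theory Defs
  imports Complex_Main "HOL-Library.Multiset" "HOL-Computational_Algebra.Polynomial"
    "Jordan_Normal_Form.Char_Poly"
begin

section \<open>Finite simple graphs with enumerated vertices and edges\<close>

text \<open>The lists enumerate the vertices \<open>v\<^sub>1, \<dots>, v\<^sub>n\<close> and the edges \<open>e\<^sub>1, \<dots>, e\<^sub>m\<close>, so that
  \<open>n = length vs\<close> and \<open>m = length es\<close>; matrix indices start at 0.\<close>

locale simple_graph =
  fixes vs :: "'a list" and es :: "'a set list"
  assumes distinct_vertices: "distinct vs"
    and distinct_edges: "distinct es"
    and edge_wf: "\<And>e. e \<in> set es \<Longrightarrow> e \<subseteq> set vs \<and> card e = 2"

definition incidence_mat :: "'a list \<Rightarrow> 'a set list \<Rightarrow> real mat" where
  "incidence_mat vs es =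
     mat (length vs) (length es) (\<lambda>(i, j). if vs ! i \<in> es ! j then 1 else 0)"

definition adjacency_mat :: "'a list \<Rightarrow> 'a set list \<Rightarrow> real mat" where
  "adjacency_mat vs es =
     mat (length vs) (length vs) (\<lambda>(i, j). if {vs ! i, vs ! j} \<in> set es then 1 else 0)"

definition vertex_degree :: "'a set list \<Rightarrow> 'a \<Rightarrow> nat" where
  "vertex_degree es v = card {e \<in> set es. v \<in> e}"

definition degree_mat :: "'a list \<Rightarrow> 'a set list \<Rightarrow> real mat" where
  "degree_mat vs es = mat_diag (length vs) (\<lambda>i. real (vertex_degree es (vs ! i)))"

definition signless_laplacian :: "'a list \<Rightarrow> 'a set list \<Rightarrow> real mat" where
  "signless_laplacian vs es = degree_mat vs es + adjacency_mat vs es"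

lemma (in simple_graph) signless_laplacian_eq:
  "signless_laplacian vs es = incidence_mat vs es * transpose_mat (incidence_mat vs es)"
proof (rule eq_matI)
  fix i j
  assume "i < dim_row (incidence_mat vs es * transpose_mat (incidence_mat vs es))"
    and "j < dim_col (incidence_mat vs es * transpose_mat (incidence_mat vs es))"
  then have i: "i < length vs" and j: "j < length vs"
    by (simp_all add: incidence_mat_def)
  let ?S = "{e \<in> set es. vs ! i \<in> e \<and> vs ! j \<in> e}"
  have "(incidence_mat vs es * transpose_mat (incidence_mat vs es)) $$ (i, j)
      = (\<Sum>k = 0..<length es. if vs ! i \<in> es ! k \<and> vs ! j \<in> es ! k then 1 else 0)"
    using i j by (auto simp: incidence_mat_def scalar_prod_def intro!: sum.cong)
  also have "\<dots> = (\<Sum>e\<in>set es. if vs ! i \<in> e \<and> vs ! j \<in> e then 1 else 0)"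
    by (rule sum.reindex_bij_betw)
      (use bij_betw_nth[OF distinct_edges] in \<open>auto simp: atLeast0LessThan\<close>)
  also have "\<dots> = real (card ?S)"
    by (simp add: sum.If_cases Int_def)
  also have "\<dots> = signless_laplacian vs es $$ (i, j)"
  proof (cases "i = j")
    case True
    have "{vs ! j} \<notin> set es"
      using edge_wf[of "{vs ! j}"] by auto
    then show ?thesis
      using i True by (simp add: signless_laplacian_def degree_mat_def adjacency_mat_def
          vertex_degree_def mat_diag_def)
  next
    case False
    then have ne: "vs ! i \<noteq> vs ! j"
      using distinct_vertices i j by (simp add: nth_eq_iff_index_eq)
    have "e = {vs ! i, vs ! j}" if "e \<in> ?S" for e
    proof -
      have "card e = 2" and "{vs ! i, vs ! j} \<subseteq> e"
        using that edge_wf by auto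
      then show ?thesis
        using ne by (auto simp: card_2_iff)
    qed
    then have "?S = (if {vs ! i, vs ! j} \<in> set es then {{vs ! i, vs ! j}} else {})"
      by auto
    then show ?thesis
      using i j False by (simp add: signless_laplacian_def degree_mat_def adjacency_mat_def
          mat_diag_def)
  qed
  finally show "signless_laplacian vs es $$ (i, j)
      = (incidence_mat vs es * transpose_mat (incidence_mat vs es)) $$ (i, j)" ..
qed (simp_all add: signless_laplacian_def degree_mat_def adjacency_mat_def incidence_mat_def)

section \<open>Eigenvalues, singular values, incidence energy\<close>

text \<open>The eigenvalues with algebraic multiplicity are the roots of the characteristic polynomial.
  Only real roots are collected; this loses nothing for the real symmetric matrices the notion is
  applied to, which have as many real eigenvalues as rows.\<close>

definition eigenvalue_mset :: "real mat \<Rightarrow> real multiset" where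
  "eigenvalue_mset A = proots (char_poly A)"

text \<open>There is one singular value for each row of the matrix, zeros included.\<close>

definition singular_value_mset :: "real mat \<Rightarrow> real multiset" where
  "singular_value_mset B = image_mset sqrt (eigenvalue_mset (B * transpose_mat B))"

definition incidence_energy :: "'a list \<Rightarrow> 'a set list \<Rightarrow> real" where
  "incidence_energy vs es = (\<Sum>q\<in>#eigenvalue_mset (signless_laplacian vs es). sqrt q)"

section \<open>Generalized graph entropies of a family of numbers\<close>

definition prob_weight :: "real multiset \<Rightarrow> real \<Rightarrow> real" where
  "prob_weight M \<mu> = \<bar>\<mu>\<bar> / (\<Sum>\<nu>\<in>#M. \<bar>\<nu>\<bar>)"

definition entropy1 :: "real multiset \<Rightarrow> real" where
  "entropy1 M = (\<Sum>\<mu>\<in>#M. prob_weight M \<mu> * (1 - prob_weight M \<mu>))"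

text \<open>Weights may vanish. For \<open>\<alpha> > 0\<close> this is harmless; for \<open>\<alpha> \<le> 0\<close> the library convention
  \<open>0 powr \<alpha> = 0\<close> restricts the sums of powers below to the support of the weights.\<close>

definition entropy2 :: "real \<Rightarrow> real \<Rightarrow> real multiset \<Rightarrow> real" where
  "entropy2 b \<alpha> M = 1 / (1 - \<alpha>) * log b (\<Sum>\<mu>\<in>#M. prob_weight M \<mu> powr \<alpha>)"

definition entropy3 :: "real \<Rightarrow> real multiset \<Rightarrow> real" where
  "entropy3 \<alpha> M = ((\<Sum>\<mu>\<in>#M. prob_weight M \<mu> powr \<alpha>) - 1) / (2 powr (1 - \<alpha>) - 1)"

end

theory Submission
  imports Defs "Jordan_Normal_Form.Schur_Decomposition"
begin

text \<open>All three entropies are functions of the weights \<open>p = \<sigma> / IE\<close>, where \<open>\<sigma> = sqrt q\<close> runs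
  through the singular values and \<open>IE\<close> is their sum, the incidence energy. A constant power of
  \<open>IE\<close> factors out of each sum of powers of the weights. This gives (ii) and (iii),
  and it turns (i) into \<open>\<Sum>p - \<Sum>p\<^sup>2 = 1 - \<Sum>q / IE\<^sup>2\<close>, so that what remains is \<open>\<Sum>q = 2 m\<close>: the
  eigenvalues of \<open>Q\<close> sum to its trace, which is the sum of the vertex degrees.

  The spectral facts behind this are that the Gram matrix \<open>B B\<^sup>T\<close> has a full set of real and
  nonnegative eigenvalues (\<open>char_poly_gram_factorized\<close>) and that they sum to its trace
  (\<open>sum_eigenvalues_eq_trace\<close>). Nonnegativity lets the weights be written without absolute
  values and gives \<open>(sqrt q)\<^sup>2 = q\<close>; having as many real eigenvalues as rows is needed for the
  trace. The assumption \<open>m > 0\<close> gives \<open>\<Sum>q > 0\<close>, hence \<open>IE > 0\<close>, so that the weights do sum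
  to 1.\<close>

section \<open>The eigenvalues of a real Gram matrix\<close>

text \<open>If \<open>C C\<^sup>T v = a v\<close>, where \<open>C\<close> is the matrix \<open>B\<close> over the complex numbers, then pairing with
  the conjugate of \<open>v\<close> gives \<open>a \<parallel>v\<parallel>\<^sup>2 = \<parallel>C\<^sup>T v\<parallel>\<^sup>2\<close>, so \<open>a\<close> is a quotient of two nonnegative
  reals.\<close>

lemma eigenvalue_complex_gram_real_nonneg:
  fixes B :: "real mat"
  assumes ev: "eigenvalue (map_mat complex_of_real (B * transpose_mat B)) a"
  shows "\<exists>r\<ge>0. a = complex_of_real r"
proof -
  define n k where "n = dim_row B" and "k = dim_col B"
  have B: "B \<in> carrier_mat n k"
    by (simp add: n_def k_def)
  let ?C = "map_mat complex_of_real B"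
  have C: "?C \<in> carrier_mat n k" and CT: "transpose_mat ?C \<in> carrier_mat k n"
    using B by auto
  have gram: "map_mat complex_of_real (B * transpose_mat B) = ?C * transpose_mat ?C"
    using of_real_hom.mat_hom_mult[of B n k "transpose_mat B" n] B
    by (simp add: map_mat_transpose)
  from ev obtain v where v: "v \<in> carrier_vec n" and "v \<noteq> 0\<^sub>v n"
    and eq: "(?C * transpose_mat ?C) *\<^sub>v v = a \<cdot>\<^sub>v v"
    unfolding eigenvalue_def eigenvector_def gram using C by auto
  let ?u = "transpose_mat ?C *\<^sub>v v"
  have u: "?u \<in> carrier_vec k"
    using CT v by auto
  have "?u \<bullet>c ?u = v \<bullet> (?C *\<^sub>v conjugate ?u)"
    using transpose_vec_mult_scalar[OF C _ v, of "conjugate ?u"] u by simp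
  also have "\<dots> = v \<bullet> conjugate (a \<cdot>\<^sub>v v)"
  proof -
    \<comment> \<open>Conjugation commutes with multiplication by \<open>C\<close>, whose entries are real.\<close>
    have "?C *\<^sub>v conjugate ?u = conjugate (?C *\<^sub>v ?u)"
      using B v by (intro eq_vecI) (auto simp: scalar_prod_def sum_conjugate conjugate_dist_mul
          intro!: sum.cong)
    then show ?thesis
      using eq C CT v by simp
  qed
  also have "\<dots> = cnj a * (v \<bullet>c v)"
    using v by (simp add: conjugate_smult_vec)
  finally have pairing: "?u \<bullet>c ?u = cnj a * (v \<bullet>c v)" .
  obtain s where s: "s \<ge> 0" "?u \<bullet>c ?u = complex_of_real s"
    using conjugate_square_ge_0_vec[of ?u] by (auto simp: less_eq_complex_def complex_eq_iff)
  obtain t where t: "t > 0" "v \<bullet>c v = complex_of_real t"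
    using conjugate_square_greater_0_vec[OF v] \<open>v \<noteq> 0\<^sub>v n\<close>
    by (auto simp: less_complex_def complex_eq_iff)
  have "cnj a = complex_of_real (s / t)"
    using pairing s t by (simp add: field_simps)
  then have "a = complex_of_real (s / t)"
    by (metis complex_cnj_cnj complex_cnj_complex_of_real)
  then show ?thesis
    using s t by (intro exI[of _ "s / t"]) auto
qed

text \<open>The fundamental theorem of algebra factors the characteristic polynomial over the complex
  numbers. All its roots are real, and the factorization descends because the embedding of real
  into complex polynomials is injective.\<close>

lemma char_poly_gram_factorized:
  fixes B :: "real mat"
  obtains rs where "char_poly (B * transpose_mat B) = (\<Prod>r\<leftarrow>rs. [:- r, 1:])"
    and "\<And>r. r \<in> set rs \<Longrightarrow> r \<ge> 0"
proof -
  let ?A = "B * transpose_mat B"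
  let ?AC = "map_mat complex_of_real ?A"
  have A: "?A \<in> carrier_mat (dim_row B) (dim_row B)"
    by auto
  then have AC: "?AC \<in> carrier_mat (dim_row B) (dim_row B)"
    by simp
  obtain as where as: "char_poly ?AC = (\<Prod>a\<leftarrow>as. [:- a, 1:])"
    using char_poly_factorized[OF AC] by blast
  have "\<exists>r\<ge>0. a = complex_of_real r" if "a \<in> set as" for a
  proof -
    have "poly (char_poly ?AC) a = 0"
      unfolding as using that by (rule linear_poly_root)
    then show ?thesis
      using eigenvalue_root_char_poly[OF AC] eigenvalue_complex_gram_real_nonneg by blast
  qed
  then have real: "complex_of_real (Re a) = a" "Re a \<ge> 0" if "a \<in> set as" for a
    using that by fastforce+
  interpret poly_hom: map_poly_inj_comm_ring_hom complex_of_real ..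
  have "map_poly complex_of_real (char_poly ?A) = (\<Prod>a\<leftarrow>as. [:- a, 1:])"
    using of_real_hom.char_poly_hom[OF A, where 'a = complex] as by metis
  also have "\<dots> = (\<Prod>a\<leftarrow>as. map_poly complex_of_real [:- Re a, 1:])"
    using real by (intro arg_cong[of _ _ prod_list] map_cong) auto
  also have "\<dots> = map_poly complex_of_real (\<Prod>r\<leftarrow>map Re as. [:- r, 1:])"
    by (simp add: poly_hom.hom_prod_list o_def)
  finally have "char_poly ?A = (\<Prod>r\<leftarrow>map Re as. [:- r, 1:])"
    by (rule poly_hom.injectivity)
  then show thesis
    by (rule that) (use real(2) in auto)
qed

lemma proots_prod_linear_factors:
  fixes rs :: "'a :: idom list"
  shows "proots (\<Prod>r\<leftarrow>rs. [:- r, 1:]) = mset rs"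
proof (induction rs)
  case (Cons r rs)
  have "(\<Prod>r\<leftarrow>rs. [:- r, 1:]) \<noteq> 0"
    by (auto simp: prod_list_zero_iff)
  then have "proots ([:- r, 1:] * (\<Prod>r\<leftarrow>rs. [:- r, 1:])) = {#r#} + mset rs"
    using Cons.IH by (subst proots_mult) auto
  then show ?case
    by simp
qed simp

lemma eigenvalue_gram_nonneg:
  assumes "q \<in># eigenvalue_mset (B * transpose_mat B)"
  shows "q \<ge> 0"
proof -
  obtain rs where "char_poly (B * transpose_mat B) = (\<Prod>r\<leftarrow>rs. [:- r, 1:])"
    and nonneg: "\<And>r. r \<in> set rs \<Longrightarrow> r \<ge> 0"
    using char_poly_gram_factorized[of B] by blast
  then have "eigenvalue_mset (B * transpose_mat B) = mset rs"
    by (simp add: eigenvalue_mset_def proots_prod_linear_factors)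
  then show ?thesis
    using assms nonneg by simp
qed

section \<open>The trace\<close>

definition trace :: "'a :: comm_monoid_add mat \<Rightarrow> 'a" where
  "trace A = (\<Sum>i<dim_row A. A $$ (i, i))"

lemma trace_mult_commute:
  fixes A B :: "'a :: comm_semiring_0 mat"
  assumes "A \<in> carrier_mat n k" and "B \<in> carrier_mat k n"
  shows "trace (A * B) = trace (B * A)"
proof -
  have "trace (A * B) = (\<Sum>i<n. \<Sum>j<k. A $$ (i, j) * B $$ (j, i))"
    using assms by (auto simp: trace_def scalar_prod_def atLeast0LessThan)
  also have "\<dots> = (\<Sum>j<k. \<Sum>i<n. B $$ (j, i) * A $$ (i, j))"
    by (subst sum.swap) (simp add: mult.commute)
  also have "\<dots> = trace (B * A)"
    using assms by (auto simp: trace_def scalar_prod_def atLeast0LessThan)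
  finally show ?thesis .
qed

text \<open>A Schur decomposition makes the matrix similar to a triangular one that has the roots of the
  characteristic polynomial on its diagonal, and similar matrices have the same trace.\<close>

lemma sum_eigenvalues_eq_trace:
  fixes A :: "real mat"
  assumes A: "A \<in> carrier_mat n n" and split: "char_poly A = (\<Prod>r\<leftarrow>rs. [:- r, 1:])"
  shows "(\<Sum>q\<in>#eigenvalue_mset A. q) = trace A"
proof -
  obtain T P R where "schur_decomposition A rs = (T, P, R)"
    by (cases "schur_decomposition A rs")
  then have sim: "similar_mat_wit A T P R" and diag: "diag_mat T = rs"
    using schur_decomposition[OF A split] by auto
  note wit = similar_mat_witD2[OF A sim]
  have "trace A = trace (P * (T * R))"
    using wit by (simp add: assoc_mult_mat[of P n n T n R n])
  also have "\<dots> = trace (T * R * P)"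
    using wit by (intro trace_mult_commute[of _ n n]) auto
  also have "\<dots> = trace T"
    using wit by (simp add: assoc_mult_mat[of T n n R n P n])
  also have "\<dots> = sum_list (diag_mat T)"
    by (simp add: trace_def diag_mat_def sum_list_sum_nth atLeast0LessThan)
  also have "\<dots> = (\<Sum>q\<in>#eigenvalue_mset A. q)"
    by (simp add: diag eigenvalue_mset_def split proots_prod_linear_factors sum_mset_sum_list)
  finally show ?thesis ..
qed

text \<open>The trace of \<open>I I\<^sup>T\<close> is also that of \<open>I\<^sup>T I\<close>, whose diagonal entry at an edge counts the
  two end points of that edge.\<close>

lemma (in simple_graph) trace_signless_laplacian:
  "trace (signless_laplacian vs es) = 2 * real (length es)"
proof -
  let ?I = "incidence_mat vs es"
  have I: "?I \<in> carrier_mat (length vs) (length es)"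
    by (simp add: incidence_mat_def)
  have diag: "(transpose_mat ?I * ?I) $$ (k, k) = 2" if k: "k < length es" for k
  proof -
    have e: "es ! k \<subseteq> set vs" "card (es ! k) = 2"
      using edge_wf k by auto
    have "(transpose_mat ?I * ?I) $$ (k, k)
        = (\<Sum>i<length vs. if vs ! i \<in> es ! k then 1 else 0)"
      using k by (auto simp: incidence_mat_def scalar_prod_def atLeast0LessThan intro!: sum.cong)
    also have "\<dots> = (\<Sum>v\<in>set vs. if v \<in> es ! k then 1 else 0)"
      by (rule sum.reindex_bij_betw)
        (use bij_betw_nth[OF distinct_vertices] in auto)
    also have "\<dots> = real (card (es ! k))"
      using e(1) by (simp add: sum.If_cases Int_absorb1)
    finally show ?thesis
      using e(2) by simp
  qed
  have "trace (signless_laplacian vs es) = trace (transpose_mat ?I * ?I)"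
    unfolding signless_laplacian_eq using I by (intro trace_mult_commute) auto
  also have "\<dots> = (\<Sum>k<length es. 2)"
    unfolding trace_def using I diag by (intro sum.cong) auto
  finally show ?thesis
    by simp
qed

lemma (in simple_graph) sum_eigenvalues_signless_laplacian:
  "(\<Sum>q\<in>#eigenvalue_mset (signless_laplacian vs es). q) = 2 * real (length es)"
proof -
  obtain rs where "char_poly (signless_laplacian vs es) = (\<Prod>r\<leftarrow>rs. [:- r, 1:])"
    unfolding signless_laplacian_eq by (rule char_poly_gram_factorized)
  then show ?thesis
    using sum_eigenvalues_eq_trace[of "signless_laplacian vs es" "length vs" rs]
      trace_signless_laplacian
    by (simp add: signless_laplacian_def degree_mat_def adjacency_mat_def)
qed

section \<open>Entropies of a family of nonnegative numbers\<close>

lemma prob_weight_nonneg_family: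
  assumes "\<And>\<mu>. \<mu> \<in># M \<Longrightarrow> \<mu> \<ge> 0" and "\<mu> \<in># M"
  shows "prob_weight M \<mu> = \<mu> / sum_mset M"
proof -
  have "image_mset abs M = image_mset (\<lambda>\<nu>. \<nu>) M"
    using assms(1) by (intro image_mset_cong) auto
  then show ?thesis
    using assms by (simp add: prob_weight_def)
qed

lemma sum_mset_divide_distrib:
  fixes f :: "'a \<Rightarrow> 'b :: field"
  shows "(\<Sum>x\<in>#M. f x) / c = (\<Sum>x\<in>#M. f x / c)"
  by (induction M) (simp_all add: add_divide_distrib)

lemma sum_prob_weight_powr:
  assumes nonneg: "\<And>\<mu>. \<mu> \<in># M \<Longrightarrow> \<mu> \<ge> 0"
  shows "(\<Sum>\<mu>\<in>#M. prob_weight M \<mu> powr \<alpha>) = (\<Sum>\<mu>\<in>#M. \<mu> powr \<alpha>) / sum_mset M powr \<alpha>"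
proof -
  have "sum_mset M \<ge> 0"
    using nonneg by (induction M) auto
  then have "(\<Sum>\<mu>\<in>#M. prob_weight M \<mu> powr \<alpha>)
      = (\<Sum>\<mu>\<in>#M. \<mu> powr \<alpha> / sum_mset M powr \<alpha>)"
    using nonneg
    by (intro arg_cong[of _ _ sum_mset] image_mset_cong)
      (simp add: prob_weight_nonneg_family[OF nonneg] powr_divide)
  also have "\<dots> = (\<Sum>\<mu>\<in>#M. \<mu> powr \<alpha>) / sum_mset M powr \<alpha>"
    by (rule sum_mset_divide_distrib[symmetric])
  finally show ?thesis .
qed

lemma sum_mset_nonneg_eq_0_iff:
  fixes M :: "'a :: ordered_comm_monoid_add multiset"
  assumes "\<And>\<mu>. \<mu> \<in># M \<Longrightarrow> \<mu> \<ge> 0"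
  shows "sum_mset M = 0 \<longleftrightarrow> (\<forall>\<mu>\<in>#M. \<mu> = 0)"
  using assms
proof (induction M)
  case (add \<mu> M)
  then have "sum_mset M \<ge> 0"
    using sum_mset_mono[of M "\<lambda>_. 0" "\<lambda>\<nu>. \<nu>"] by simp
  then show ?case
    using add by (simp add: add_nonneg_eq_0_iff)
qed simp

lemma sum_mset_diff_distrib:
  fixes f g :: "'a \<Rightarrow> 'b :: ab_group_add"
  shows "(\<Sum>x\<in>#M. f x - g x) = (\<Sum>x\<in>#M. f x) - (\<Sum>x\<in>#M. g x)"
  by (induction M) (simp_all add: algebra_simps)

lemma entropy1_nonneg_family:
  assumes nonneg: "\<And>\<mu>. \<mu> \<in># M \<Longrightarrow> \<mu> \<ge> 0" and nonzero: "sum_mset M \<noteq> 0"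
  shows "entropy1 M = 1 - (\<Sum>\<mu>\<in>#M. \<mu>\<^sup>2) / (sum_mset M)\<^sup>2"
proof -
  let ?S = "sum_mset M"
  have "entropy1 M = (\<Sum>\<mu>\<in>#M. \<mu> / ?S - \<mu>\<^sup>2 / ?S\<^sup>2)"
    unfolding entropy1_def
    by (intro arg_cong[of _ _ sum_mset] image_mset_cong)
      (simp add: prob_weight_nonneg_family[OF nonneg] power2_eq_square right_diff_distrib)
  also have "\<dots> = ?S / ?S - (\<Sum>\<mu>\<in>#M. \<mu>\<^sup>2) / ?S\<^sup>2"
    by (simp add: sum_mset_diff_distrib flip: sum_mset_divide_distrib)
  also have "\<dots> = 1 - (\<Sum>\<mu>\<in>#M. \<mu>\<^sup>2) / ?S\<^sup>2"
    using nonzero by simp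
  finally show ?thesis .
qed

section \<open>Entropies of the singular values of the incidence matrix\<close>

theorem theorem3p5:
  fixes vs :: "'a list" and es :: "'a set list" and n m :: nat and b \<alpha> :: real
  assumes "simple_graph vs es"
    and "length vs = n" and "length es = m"
    and "m > 0"
    and "b > 0" and "b \<noteq> 1"
    and "\<alpha> \<noteq> 1"
  shows
    "entropy1 (singular_value_mset (incidence_mat vs es))
         = 1 - 2 * real m / (incidence_energy vs es)\<^sup>2
     \<and> entropy2 b \<alpha> (singular_value_mset (incidence_mat vs es))
         = 1 / (1 - \<alpha>) *
           log b ((\<Sum>q\<in>#eigenvalue_mset (signless_laplacian vs es). sqrt q powr \<alpha>)
                  / incidence_energy vs es powr \<alpha>)
     \<and> entropy3 \<alpha> (singular_value_mset (incidence_mat vs es))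
         = 1 / (2 powr (1 - \<alpha>) - 1) *
           ((\<Sum>q\<in>#eigenvalue_mset (signless_laplacian vs es). sqrt q powr \<alpha>)
              / incidence_energy vs es powr \<alpha> - 1)"
proof -
  interpret simple_graph vs es
    by fact
  let ?Q = "eigenvalue_mset (signless_laplacian vs es)"
  define M where "M = image_mset sqrt ?Q"
  have M: "singular_value_mset (incidence_mat vs es) = M"
    by (simp add: singular_value_mset_def M_def signless_laplacian_eq)
  have IE: "incidence_energy vs es = sum_mset M"
    by (simp add: incidence_energy_def M_def)
  have Q_nonneg: "q \<ge> 0" if "q \<in># ?Q" for q
    using that eigenvalue_gram_nonneg unfolding signless_laplacian_eq by blast
  then have nonneg: "\<mu> \<ge> 0" if "\<mu> \<in># M" for \<mu>
    using that by (auto simp: M_def)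
  have "(\<Sum>\<mu>\<in>#M. \<mu>\<^sup>2) = (\<Sum>q\<in>#?Q. q)"
    using Q_nonneg unfolding M_def image_mset.compositionality o_def
    by (intro arg_cong[of _ _ sum_mset] image_mset_cong) simp
  then have squares: "(\<Sum>\<mu>\<in>#M. \<mu>\<^sup>2) = 2 * real m"
    using sum_eigenvalues_signless_laplacian \<open>length es = m\<close> by simp
  \<comment> \<open>If the nonnegative singular values summed to 0, they would all vanish and so would the sum
    of their squares.\<close>
  have "sum_mset M \<noteq> 0"
  proof
    assume "sum_mset M = 0"
    then have "\<mu> = 0" if "\<mu> \<in># M" for \<mu>
      using nonneg that by (auto simp: sum_mset_nonneg_eq_0_iff)
    then have "(\<Sum>\<mu>\<in>#M. \<mu>\<^sup>2) = (\<Sum>\<mu>\<in>#M. 0)"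
      by (intro arg_cong[of _ _ sum_mset] image_mset_cong) simp
    then show False
      using squares \<open>m > 0\<close> by simp
  qed
  then have "entropy1 M = 1 - 2 * real m / (sum_mset M)\<^sup>2"
    using entropy1_nonneg_family[OF nonneg] squares by simp
  moreover have "(\<Sum>\<mu>\<in>#M. prob_weight M \<mu> powr \<alpha>)
      = (\<Sum>q\<in>#?Q. sqrt q powr \<alpha>) / sum_mset M powr \<alpha>"
  proof -
    have "(\<Sum>\<mu>\<in>#M. \<mu> powr \<alpha>) = (\<Sum>q\<in>#?Q. sqrt q powr \<alpha>)"
      by (simp add: M_def image_mset.compositionality o_def)
    then show ?thesis
      using sum_prob_weight_powr[OF nonneg] by simp
  qed
  ultimately show ?thesis
    unfolding M IE entropy2_def entropy3_def by simp
qed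

end
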